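(* Let $\mathcal{V}$ be a vector space and let $T:\mathcal{V}\to\mathcal{V}$ be an injective linear map. Then there exist linear subspaces $\mathcal{V}_b,\mathcal{V}_s\subseteq\mathcal{V}$ with $\mathcal{V}=\mathcal{V}_b\oplus\mathcal{V}_s$ (internal direct sum) such that $\mathcal{V}_b$ is $T$-invariant (i.e. $T(\mathcal{V}_b)\subseteq\mathcal{V}_b$), the restriction $T_{|\mathcal{V}_b}:\mathcal{V}_b\to\mathcal{V}_b$ is a bijection, and the restriction $T_{|\mathcal{V}_s}:\mathcal{V}_s\to\mathcal{V}$ is a shift, i.e. $\bigcap_{n=0}^{\infty}T^n(\mathcal{V}_s)=\{0\}$.
   Context: Vector spaces are over an arbitrary field. A linear map $T:\mathcal{V}\to\mathcal{V}$ on a vector space is called a shift if $\bigcap_{n=0}^\infty T^n(\mathcal{V})=\{0\}$, where $T^0$ is the identity. For the restriction of $T$ to a subspace $\mathcal{V}_s$ (which need not be $T$-invariant), being a shift means $\bigcap_{n=0}^{\infty}T^n(\mathcal{V}_s)=\{0\}$, where $T^n(\mathcal{V}_s)$ is the image of $\mathcal{V}_s$ under $T^n:\mathcal{V}\to\mathcal{V}$. *)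

theory Defs
  imports Complex_Main
begin

text \<open>Internal direct sum of two subspaces; being subspaces is not part of this predicate.\<close>

definition internal_direct_sum :: "'v::ab_group_add set \<Rightarrow> 'v set \<Rightarrow> 'v set \<Rightarrow> bool" where
  "internal_direct_sum V A B \<longleftrightarrow> V = {a + b | a b. a \<in> A \<and> b \<in> B} \<and> A \<inter> B = {0}"

text \<open>The set \<open>W\<close> need not be \<open>T\<close>-invariant: the powers are those of \<open>T\<close> on the whole space.
  The intersection includes \<open>n = 0\<close>, i.e. \<open>W\<close> itself.\<close>

definition shift_on :: "('v::zero \<Rightarrow> 'v) \<Rightarrow> 'v set \<Rightarrow> bool" where
  "shift_on T W \<longleftrightarrow> (\<Inter>n::nat. (T ^^ n) ` W) = {0}"

end

theory Submission
  imports Defs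
begin

text \<open>Take \<open>Vb = (\<Inter>n. T\<^sup>n V)\<close>, which an injective \<open>T\<close> maps onto itself, and let \<open>Vs\<close> be an arbitrary
  complement of \<open>Vb\<close>. Every vector in \<open>\<Inter>n. T\<^sup>n Vs\<close> lies in \<open>Vs\<close> (the case \<open>n = 0\<close>) and in \<open>Vb\<close>, so it
  is zero.\<close>

text \<open>A linear projection \<open>p\<close> onto \<open>W\<close> provides the complement: its
  kernel, through the splitting \<open>x = p x + (x - p x)\<close>.\<close>

lemma (in vector_space) exists_complement:
  assumes W: "subspace W"
  shows "\<exists>U. subspace U \<and> internal_direct_sum UNIV W U"
proof -
  interpret vector_space_pair scale scale ..
  have "Vector_Spaces.linear scale scale id"
    by (rule linear_id)
  \<comment> \<open>A left inverse of \<open>id\<close> on \<open>W\<close> with range inside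
    \<open>W\<close> is exactly such a projection.\<close>
  then obtain p where p: "range p \<subseteq> W" "Vector_Spaces.linear scale scale p" "\<forall>v\<in>W. p v = v"
    using linear_exists_left_inverse_on[of id W] W by auto
  define U where "U = {x. p x = 0}"
  have "subspace U"
    unfolding U_def using p(2) by (rule linear_subspace_kernel)
  moreover have "\<exists>a b. x = a + b \<and> a \<in> W \<and> b \<in> U" for x
  proof (intro exI conjI)
    show "x = p x + (x - p x)" "p x \<in> W"
      using p(1) by auto
    show "x - p x \<in> U"
      using p \<open>p x \<in> W\<close> by (simp add: U_def linear_diff)
  qed
  moreover have "W \<inter> U = {0}"
    using p(3) subspace_0[OF W] by (auto simp: U_def)
  ultimately show ?thesis
    unfolding internal_direct_sum_def by blast
qed

text \<open>Injectivity lets the image commute with the intersection, so applying \<open>T\<close>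
  merely raises every exponent by one. The term lost at \<open>n = 0\<close> is the whole space and
  does not constrain the intersection.\<close>

lemma inj_image_INT_funpow:
  assumes "inj T"
  shows "T ` (\<Inter>n. range (T ^^ n)) = (\<Inter>n. range (T ^^ n))"
proof -
  have "T ` (\<Inter>n. range (T ^^ n)) = (\<Inter>n. T ` range (T ^^ n))"
    using assms by (simp add: image_INT)
  also have "\<dots> = (\<Inter>n. range (T ^^ Suc n))"
    by (simp add: image_comp)
  also have "\<dots> = (\<Inter>n. range (T ^^ n))"
  proof (intro antisym INT_greatest)
    fix n
    show "(\<Inter>m. range (T ^^ Suc m)) \<subseteq> range (T ^^ n)"
      by (cases n) auto
  qed blast
  finally show ?thesis .
qed

theorem theorem2p3:
  fixes scale :: "'k::field \<Rightarrow> 'v::ab_group_add \<Rightarrow> 'v"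
    and T :: "'v \<Rightarrow> 'v"
  assumes "vector_space scale"
    and "Vector_Spaces.linear scale scale T"
    and "inj T"
  shows "\<exists>Vb Vs. module.subspace scale Vb \<and> module.subspace scale Vs
    \<and> internal_direct_sum UNIV Vb Vs
    \<and> T ` Vb \<subseteq> Vb \<and> bij_betw T Vb Vb
    \<and> shift_on T Vs"
proof -
  interpret vector_space scale by fact
  interpret vector_space_pair scale scale ..
  define Vb where "Vb = (\<Inter>n. range (T ^^ n))"
  have lin: "Vector_Spaces.linear scale scale (T ^^ n)" for n
  proof (induction n)
    case 0
    show ?case by (simp add: id_def linear_ident)
  next
    case (Suc n)
    then show ?case
      unfolding funpow.simps using assms(2) by (rule Vector_Spaces.linear_compose)
  qed
  have "subspace Vb"
    unfolding Vb_def by (auto intro!: subspace_Inter linear_subspace_image lin)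
  then obtain Vs where Vs: "subspace Vs" "internal_direct_sum UNIV Vb Vs"
    using exists_complement by blast
  have T_Vb: "T ` Vb = Vb"
    unfolding Vb_def using assms(3) by (rule inj_image_INT_funpow)
  moreover have "bij_betw T Vb Vb"
    using T_Vb assms(3) by (auto simp: bij_betw_def intro: inj_on_subset)
  moreover have "shift_on T Vs"
    unfolding shift_on_def
  proof (intro antisym)
    have "(\<Inter>n. (T ^^ n) ` Vs) \<subseteq> (T ^^ 0) ` Vs" "(\<Inter>n. (T ^^ n) ` Vs) \<subseteq> Vb"
      unfolding Vb_def by blast+
    then show "(\<Inter>n. (T ^^ n) ` Vs) \<subseteq> {0}"
      using Vs(2) by (auto simp: internal_direct_sum_def)
    have "0 \<in> (T ^^ n) ` Vs" for n
      using linear_subspace_image[OF lin Vs(1)] by (rule subspace_0)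
    then show "{0} \<subseteq> (\<Inter>n. (T ^^ n) ` Vs)"
      by blast
  qed
  ultimately show ?thesis
    using \<open>subspace Vb\<close> Vs by blast
qed

end
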